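(* Let $\alpha=(b_{0,0},b_{0,1},b_{1,1},b_{1,2},b_{1,4},b_{1,6})\in\mathbb{C}^6$ and $\alpha'=(b_{0,0}',b_{0,1}',b_{1,1}',b_{1,2}',b_{1,4}',b_{1,6}')\in\mathbb{C}^6$. The algebras $L(\alpha)$ and $L(\alpha')$ from $CE(\mu_8)$ are isomorphic if and only if there exist $A_0,A_1,B_1,\dots,B_5\in\mathbb{C}$ with $A_0B_1\neq0$ such that $$b_{0,0}'=\frac{A_0^2b_{0,0}+A_0A_1b_{0,1}+A_1^2b_{1,1}}{A_0^{7}B_1},\qquad b_{0,1}'=\frac{2A_1b_{1,1}+A_0b_{0,1}}{A_0^{7}},\qquad b_{1,1}'=\frac{B_1b_{1,1}}{A_0^{7}},$$ $$b_{1,2}'=\frac{B_1^2b_{1,2}+(2B_1B_3-B_2^2)b_{1,4}+(2B_1B_5-2B_2B_4+B_3^2)b_{1,6}}{A_0^{6}B_1},$$ $$b_{1,4}'=\frac{B_1^2b_{1,4}+(2B_1B_3-B_2^2)b_{1,6}}{A_0^{4}B_1},\qquad b_{1,6}'=\frac{B_1b_{1,6}}{A_0^2}.$$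
   Context: A Leibniz algebra over $\mathbb{C}$ is a complex vector space with a bilinear bracket satisfying $[x,[y,z]]=[[x,y],z]-[[x,z],y]$. $CE(\mu_8)$ (one-dimensional Leibniz central extensions of the 8-dimensional naturally graded filiform Lie algebra $\mu_8$) is the class of the 9-dimensional complex Leibniz algebras $L(\alpha)$, $\alpha=(b_{0,0},b_{0,1},b_{1,1},b_{1,2},b_{1,4},b_{1,6})\in\mathbb{C}^6$, with basis $e_0,\dots,e_8$ and brackets $[e_i,e_0]=e_{i+1}$ ($1\le i\le 7$), $[e_0,e_i]=-e_{i+1}$ ($2\le i\le 7$), $[e_0,e_0]=b_{0,0}e_8$, $[e_0,e_1]=-e_2+b_{0,1}e_8$, $[e_1,e_1]=b_{1,1}e_8$, $[e_1,e_2]=-[e_2,e_1]=b_{1,2}e_8$, $[e_1,e_4]=-[e_4,e_1]=b_{1,4}e_8$, $[e_2,e_3]=-[e_3,e_2]=-b_{1,4}e_8$, $[e_1,e_6]=-[e_6,e_1]=b_{1,6}e_8$, $[e_2,e_5]=-[e_5,e_2]=-b_{1,6}e_8$, $[e_3,e_4]=-[e_4,e_3]=b_{1,6}e_8$, all other brackets of basis vectors being zero. Isomorphic means isomorphic as Leibniz algebras. *)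

theory Defs
  imports "HOL-Analysis.Analysis"
begin

locale leibniz_algebra = vector_space scale
  for scale :: "complex \<Rightarrow> 'a::ab_group_add \<Rightarrow> 'a" +
  fixes bracket :: "'a \<Rightarrow> 'a \<Rightarrow> 'a"
  assumes linear_left: "Vector_Spaces.linear scale scale (\<lambda>x. bracket x y)"
    and linear_right: "Vector_Spaces.linear scale scale (\<lambda>y. bracket x y)"
    and leibniz: "bracket x (bracket y z) = bracket (bracket x y) z - bracket (bracket x z) y"

definition leibniz_isomorphic ::
  "(complex \<Rightarrow> 'a::ab_group_add \<Rightarrow> 'a) \<Rightarrow> ('a \<Rightarrow> 'a \<Rightarrow> 'a) \<Rightarrow>
   (complex \<Rightarrow> 'b::ab_group_add \<Rightarrow> 'b) \<Rightarrow> ('b \<Rightarrow> 'b \<Rightarrow> 'b) \<Rightarrow> bool" where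
  "leibniz_isomorphic scale1 bracket1 scale2 bracket2 \<longleftrightarrow>
     leibniz_algebra scale1 bracket1 \<and> leibniz_algebra scale2 bracket2 \<and>
     (\<exists>f. Vector_Spaces.linear scale1 scale2 f \<and> bij f \<and>
          (\<forall>x y. f (bracket1 x y) = bracket2 (f x) (f y)))"

text \<open>The basis is indexed by the natural numbers \<open>0, \<dots>, 8\<close>, which \<open>of_nat\<close> maps bijectively
  onto the index type \<open>9\<close>; thus \<open>e (i + 1)\<close> involves no reduction modulo 9 below.\<close>

definition e :: "nat \<Rightarrow> complex ^ 9" where
  "e i = axis (of_nat i) 1"

definition L_basis_bracket ::
  "complex \<Rightarrow> complex \<Rightarrow> complex \<Rightarrow> complex \<Rightarrow> complex \<Rightarrow> complex \<Rightarrow> nat \<Rightarrow> nat \<Rightarrow> complex ^ 9" where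
  "L_basis_bracket b00 b01 b11 b12 b14 b16 i j =
    (if 1 \<le> i \<and> i \<le> 7 \<and> j = 0 then e (i + 1)
     else if i = 0 \<and> 2 \<le> j \<and> j \<le> 7 then - e (j + 1)
     else if (i, j) = (0, 0) then b00 *s e 8
     else if (i, j) = (0, 1) then - e 2 + b01 *s e 8
     else if (i, j) = (1, 1) then b11 *s e 8
     else if (i, j) = (1, 2) then b12 *s e 8
     else if (i, j) = (2, 1) then (- b12) *s e 8
     else if (i, j) = (1, 4) then b14 *s e 8
     else if (i, j) = (4, 1) then (- b14) *s e 8
     else if (i, j) = (2, 3) then (- b14) *s e 8
     else if (i, j) = (3, 2) then b14 *s e 8
     else if (i, j) = (1, 6) then b16 *s e 8
     else if (i, j) = (6, 1) then (- b16) *s e 8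
     else if (i, j) = (2, 5) then (- b16) *s e 8
     else if (i, j) = (5, 2) then b16 *s e 8
     else if (i, j) = (3, 4) then b16 *s e 8
     else if (i, j) = (4, 3) then (- b16) *s e 8
     else 0)"

definition L ::
  "complex \<Rightarrow> complex \<Rightarrow> complex \<Rightarrow> complex \<Rightarrow> complex \<Rightarrow> complex \<Rightarrow>
   complex ^ 9 \<Rightarrow> complex ^ 9 \<Rightarrow> complex ^ 9" where
  "L b00 b01 b11 b12 b14 b16 x y =
    (\<Sum>i\<le>8. \<Sum>j\<le>8. (x $ of_nat i * y $ of_nat j) *s L_basis_bracket b00 b01 b11 b12 b14 b16 i j)"

lemma sum_atMost_8: "(\<Sum>i\<le>8. f i) = f 0 + f 1 + f 2 + f 3 + f 4 + f 5 + f 6 + f 7 + f (8::nat)"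
  for f :: "nat \<Rightarrow> 'a::comm_monoid_add"
  by (simp add: eval_nat_numeral)

lemma forall_9: "(\<forall>k::9. P k) \<longleftrightarrow> P 0 \<and> P 1 \<and> P 2 \<and> P 3 \<and> P 4 \<and> P 5 \<and> P 6 \<and> P 7 \<and> P 8"
proof
  assume *: "P 0 \<and> P 1 \<and> P 2 \<and> P 3 \<and> P 4 \<and> P 5 \<and> P 6 \<and> P 7 \<and> P 8"
  show "\<forall>k. P k"
  proof
    fix k :: 9
    show "P k"
    proof (cases k)
      case (of_int z)
      then have "z = 0 \<or> z = 1 \<or> z = 2 \<or> z = 3 \<or> z = 4 \<or> z = 5 \<or> z = 6 \<or> z = 7 \<or> z = 8"
        by auto
      with * of_int show ?thesis by auto
    qed
  qed
qed auto

lemma L_component: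
  "L b00 b01 b11 b12 b14 b16 x y $ k =
    (if k = 0 \<or> k = 1 then 0
     else if k = 8 then x $ 7 * y $ 0 - x $ 0 * y $ 7
       + b00 * x $ 0 * y $ 0 + b01 * x $ 0 * y $ 1 + b11 * x $ 1 * y $ 1
       + b12 * (x $ 1 * y $ 2 - x $ 2 * y $ 1)
       + b14 * (x $ 1 * y $ 4 - x $ 4 * y $ 1 - x $ 2 * y $ 3 + x $ 3 * y $ 2)
       + b16 * (x $ 1 * y $ 6 - x $ 6 * y $ 1 - x $ 2 * y $ 5 + x $ 5 * y $ 2
                + x $ 3 * y $ 4 - x $ 4 * y $ 3)
     else x $ (k - 1) * y $ 0 - x $ 0 * y $ (k - 1))"
  (is "?P k")
proof -
  have "\<forall>k. ?P k"
    unfolding forall_9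
    by (simp add: L_def sum_atMost_8 L_basis_bracket_def e_def axis_def algebra_simps)
  then show ?thesis ..
qed

lemma leibniz_algebra_L: "leibniz_algebra (*s) (L b00 b01 b11 b12 b14 b16)"
proof unfold_locales
  show "L b00 b01 b11 b12 b14 b16 x (L b00 b01 b11 b12 b14 b16 y z) =
      L b00 b01 b11 b12 b14 b16 (L b00 b01 b11 b12 b14 b16 x y) z
    - L b00 b01 b11 b12 b14 b16 (L b00 b01 b11 b12 b14 b16 x z) y" for x y z
    unfolding vec_eq_iff forall_9
    by (simp add: L_component algebra_simps)
qed (simp_all add: vec_eq_iff forall_9 L_component algebra_simps)

lemma L_basis:
  assumes "i \<le> 8" "j \<le> 8"
  shows "L b00 b01 b11 b12 b14 b16 (e i) (e j) = L_basis_bracket b00 b01 b11 b12 b14 b16 i j"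
proof -
  have inj: "of_nat k = (of_nat l :: 9) \<longleftrightarrow> k = l" if "k \<le> 8" "l \<le> 8" for k l
  proof -
    have "k \<in> {0,1,2,3,4,5,6,7,8}" "l \<in> {0,1,2,3,4,5,6,7,8}" using that by auto
    then show ?thesis by auto
  qed
  have coord: "e m $ of_nat k = (if k = m then 1 else 0)" if "k \<le> 8" "m \<le> 8" for k m
    using inj[OF that] by (simp add: e_def axis_def)
  have "L b00 b01 b11 b12 b14 b16 (e i) (e j) =
      (\<Sum>k\<le>8. \<Sum>l\<le>8. if k = i then (if l = j then L_basis_bracket b00 b01 b11 b12 b14 b16 k l else 0) else 0)"
    unfolding L_def by (intro sum.cong refl) (use assms in \<open>simp add: coord\<close>)
  also have "\<dots> = (\<Sum>k\<le>8. if k = i then (if j \<le> 8 then L_basis_bracket b00 b01 b11 b12 b14 b16 k j else 0) else 0)"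
    by (intro sum.cong refl) (simp add: assms)
  also have "\<dots> = L_basis_bracket b00 b01 b11 b12 b14 b16 i j"
    using assms by simp
  finally show ?thesis .
qed

end

theory Submission
  imports Defs
begin

text \<open>An isomorphism from \<open>L(\<alpha>')\<close> to \<open>L(\<alpha>)\<close> is determined by the images \<open>A\<close> and \<open>B\<close> of
  \<open>e\<^sub>0\<close> and \<open>e\<^sub>1\<close>, since \<open>e\<^sub>i\<^sub>+\<^sub>1 = [e\<^sub>i, e\<^sub>0]\<close>. The image of \<open>e\<^sub>8\<close> is
  \<open>A\<^sub>0\<^sup>6 (B\<^sub>1 A\<^sub>0 - B\<^sub>0 A\<^sub>1) e\<^sub>8\<close>, so \<open>A\<^sub>0 \<noteq> 0\<close>, and the \<open>e\<^sub>3\<close>-coordinate of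
  \<open>[e\<^sub>1, e\<^sub>2] = b\<^sub>1\<^sub>2' e\<^sub>8\<close> forces \<open>B\<^sub>0 = 0\<close>. The \<open>e\<^sub>8\<close>-coordinates of the remaining relations are
  the stated formulas; the coordinates of \<open>A\<close> beyond \<open>A\<^sub>1\<close> and of \<open>B\<close> beyond \<open>B\<^sub>5\<close> drop out, so
  they can be taken to be zero for the converse.\<close>

lemma leibniz_isomorphic_sym:
  assumes "leibniz_isomorphic s1 br1 s2 br2"
  shows "leibniz_isomorphic s2 br2 s1 br1"
proof -
  from assms obtain f where alg: "leibniz_algebra s1 br1" "leibniz_algebra s2 br2"
    and lin: "Vector_Spaces.linear s1 s2 f" and bij: "bij f"
    and hom: "\<And>x y. f (br1 x y) = br2 (f x) (f y)"
    unfolding leibniz_isomorphic_def by blast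
  interpret f: Vector_Spaces.linear s1 s2 f by (fact lin)
  have inv1: "inv f (f x) = x" and inv2: "f (inv f y) = y" for x y
    using bij by (auto simp: bij_is_inj bij_is_surj surj_f_inv_f)
  have "Vector_Spaces.linear s2 s1 (inv f)"
  proof unfold_locales
    show "inv f (x + y) = inv f x + inv f y" for x y
      by (metis f.add inv1 inv2)
    show "inv f (s2 r x) = s1 r (inv f x)" for r x
      by (metis f.scale inv1 inv2)
  qed
  moreover have "inv f (br2 x y) = br1 (inv f x) (inv f y)" for x y
    by (metis hom inv1 inv2)
  ultimately show ?thesis
    using alg bij_imp_bij_inv[OF bij] unfolding leibniz_isomorphic_def by blast
qed

text \<open>The equations are kept free of denominators so that each is a polynomial identity.
  Injectivity of \<open>g\<close> enters through \<open>g (e 8) \<noteq> 0\<close>.\<close>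

lemma L_isomorphism_imp_parameters:
  fixes g :: "complex ^ 9 \<Rightarrow> complex ^ 9"
  assumes lin: "Vector_Spaces.linear (*s) (*s) g" and "inj g"
    and hom: "\<And>x y. g (L b00' b01' b11' b12' b14' b16' x y) = L b00 b01 b11 b12 b14 b16 (g x) (g y)"
  defines "A \<equiv> g (e 0)" and "B \<equiv> g (e 1)"
  shows "A $ 0 * B $ 1 \<noteq> 0"
    and "b00' * (A$0^7 * B$1) = A$0^2 * b00 + A$0 * A$1 * b01 + A$1^2 * b11"
    and "b01' * A$0^7 = 2 * A$1 * b11 + A$0 * b01"
    and "b11' * A$0^7 = B$1 * b11"
    and "b12' * (A$0^6 * B$1) = B$1^2 * b12 + (2 * B$1 * B$3 - B$2^2) * b14
                + (2 * B$1 * B$5 - 2 * B$2 * B$4 + B$3^2) * b16"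
    and "b14' * (A$0^4 * B$1) = B$1^2 * b14 + (2 * B$1 * B$3 - B$2^2) * b16"
    and "b16' * A$0^2 = B$1 * b16"
proof -
  interpret g: Vector_Spaces.linear "(*s)" "(*s)" g by (fact lin)
  let ?L = "L b00 b01 b11 b12 b14 b16"
  have hom': "g (L_basis_bracket b00' b01' b11' b12' b14' b16' i j) = ?L (g (e i)) (g (e j))"
    if "i \<le> 8" "j \<le> 8" for i j
    using hom[of "e i" "e j"] L_basis[OF that] by simp
  define E where "E i = g (e i)" for i
  have E01: "E 0 = A" "E 1 = B" by (simp_all add: E_def A_def B_def)
  have step: "E (i + 1) = ?L (E i) A" if "1 \<le> i" "i \<le> 7" for i
    using hom'[of i 0] that by (simp add: E_def A_def L_basis_bracket_def)
  define a b where "a k = A $ k" and "b k = B $ k" for k :: 9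
  have E2: "E 2 = ?L B A"
    using step[of 1] by (simp add: E01[simplified] numeral_2_eq_2)
  have E3: "E 3 = ?L (E 2) A" and E4: "E 4 = ?L (E 3) A"
    and E5: "E 5 = ?L (E 4) A" and E6: "E 6 = ?L (E 5) A" and E7: "E 7 = ?L (E 6) A"
    and E8: "E 8 = ?L (E 7) A"
    using step[of 2] step[of 3] step[of 4] step[of 5] step[of 6] step[of 7]
    by simp_all
  note comps = L_component a_def[symmetric] b_def[symmetric]
  \<comment> \<open>\<open>d\<close> is the determinant of the (0, 1)-coordinates of
    \<open>A\<close> and \<open>B\<close>, and it is the leading coordinate of \<open>E 2\<close>.
    Each further bracket with \<open>A\<close> moves the leading coordinate up one place and
    multiplies it by \<open>a 0\<close>.\<close>
  define d where "d = b 1 * a 0 - b 0 * a 1"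
  have c2: "E 2 $ 0 = 0" "E 2 $ 1 = 0" "E 2 $ 2 = d"
    unfolding E2 by (simp_all add: comps d_def)
  have c3: "E 3 $ 0 = 0" "E 3 $ 1 = 0" "E 3 $ 2 = 0" "E 3 $ 3 = d * a 0"
    unfolding E3 by (simp_all add: comps c2)
  have c4: "E 4 $ 0 = 0" "E 4 $ 1 = 0" "E 4 $ 2 = 0" "E 4 $ 3 = 0" "E 4 $ 4 = d * a 0 ^ 2"
    unfolding E4 by (simp_all add: comps c3 power2_eq_square)
  have c5: "E 5 $ 0 = 0" "E 5 $ 1 = 0" "E 5 $ 2 = 0" "E 5 $ 3 = 0" "E 5 $ 4 = 0"
    "E 5 $ 5 = d * a 0 ^ 3"
    unfolding E5 by (simp_all add: comps c4 power_numeral_reduce)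
  have c6: "E 6 $ 0 = 0" "E 6 $ 1 = 0" "E 6 $ 2 = 0" "E 6 $ 3 = 0" "E 6 $ 4 = 0" "E 6 $ 5 = 0"
    "E 6 $ 6 = d * a 0 ^ 4"
    unfolding E6 by (simp_all add: comps c5 power_numeral_reduce)
  have c7: "E 7 $ 0 = 0" "E 7 $ 1 = 0" "E 7 $ 2 = 0" "E 7 $ 3 = 0" "E 7 $ 4 = 0" "E 7 $ 5 = 0"
    "E 7 $ 6 = 0" "E 7 $ 7 = d * a 0 ^ 5"
    unfolding E7 by (simp_all add: comps c6 power_numeral_reduce)
  have c8: "E 8 $ 0 = 0" "E 8 $ 1 = 0" "E 8 $ 2 = 0" "E 8 $ 3 = 0" "E 8 $ 4 = 0" "E 8 $ 5 = 0"
    "E 8 $ 6 = 0" "E 8 $ 7 = 0" "E 8 $ 8 = d * a 0 ^ 6"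
    unfolding E8 by (simp_all add: comps c7 power_numeral_reduce)
  have "e 8 \<noteq> 0" by (simp add: e_def axis_def vec_eq_iff forall_9)
  then have "E 8 \<noteq> 0"
    using injD[OF \<open>inj g\<close>, of "e 8" 0] by (auto simp: E_def)
  then have "d * a 0 ^ 6 \<noteq> 0"
    by (auto simp: vec_eq_iff forall_9 c8)
  then have d: "d \<noteq> 0" and a0: "a 0 \<noteq> 0" by auto
  have r12: "?L B (E 2) = b12' *s E 8"
    using hom'[of 1 2] by (simp add: E_def B_def L_basis_bracket_def g.scale)
  \<comment> \<open>Coordinate 3 of \<open>?L B (E 2)\<close> is
    \<open>b 2 * E 2 $ 0 - b 0 * E 2 $ 2\<close>, whereas \<open>E 8\<close> lives in coordinate 8
    only.\<close>
  have "- b 0 * d = 0"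
    using arg_cong[OF r12, of "\<lambda>v. v $ 3"] by (simp add: comps c2 c8)
  with d have b0: "b 0 = 0" by simp
  with d have b1: "b 1 \<noteq> 0" and d_eq: "d = b 1 * a 0" by (auto simp: d_def)
  from a0 b1 show "A $ 0 * B $ 1 \<noteq> 0" by (simp add: a_def b_def)
  have r00: "?L A A = b00' *s E 8"
    using hom'[of 0 0] by (simp add: E_def A_def L_basis_bracket_def g.scale)
  have r01: "?L A B = - E 2 + b01' *s E 8"
    using hom'[of 0 1] by (simp add: E_def A_def B_def L_basis_bracket_def g.scale g.add g.neg g.diff)
  have r11: "?L B B = b11' *s E 8"
    using hom'[of 1 1] by (simp add: E_def B_def L_basis_bracket_def g.scale)
  have r14: "?L B (E 4) = b14' *s E 8"
    using hom'[of 1 4] by (simp add: E_def B_def L_basis_bracket_def g.scale)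
  have r16: "?L B (E 6) = b16' *s E 8"
    using hom'[of 1 6] by (simp add: E_def B_def L_basis_bracket_def g.scale)
  \<comment> \<open>Since \<open>b 0 = 0\<close>, below coordinate 8 the vector \<open>E i\<close>
    is \<open>B\<close> shifted up by i - 1 places and scaled by
    \<open>a 0 ^ (i - 1)\<close>.\<close>
  have m2: "E 2 $ 3 = b 2 * a 0" "E 2 $ 4 = b 3 * a 0" "E 2 $ 5 = b 4 * a 0" "E 2 $ 6 = b 5 * a 0"
    unfolding E2 by (simp_all add: comps b0)
  have m3: "E 3 $ 4 = b 2 * a 0 ^ 2" "E 3 $ 5 = b 3 * a 0 ^ 2"
    unfolding E3 by (simp_all add: comps c2 m2 power2_eq_square)
  have m4: "E 4 $ 5 = b 2 * a 0 ^ 3" "E 4 $ 6 = b 3 * a 0 ^ 3"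
    unfolding E4 by (simp_all add: comps c3 m3 power_numeral_reduce)
  note p = arg_cong[where f = "\<lambda>v. v $ 8"]
  show "b00' * (A$0^7 * B$1) = A$0^2 * b00 + A$0 * A$1 * b01 + A$1^2 * b11"
    using p[OF r00] by (simp add: comps c8 d_eq) algebra
  \<comment> \<open>With \<open>E 2\<close> unfolded to \<open>?L B A\<close>, the skew terms of
    \<open>?L A B\<close> and \<open>?L B A\<close> cancel. The symmetric \<open>b11\<close> term
    occurs in both, hence the factor 2.\<close>
  have "b 1 * (b01' * a 0 ^ 7) = b 1 * (2 * a 1 * b11 + a 0 * b01)"
    using p[OF r01[unfolded E2]] by (simp add: comps c8 d_eq b0) algebra
  with b1 show "b01' * A$0^7 = 2 * A$1 * b11 + A$0 * b01"
    by (simp add: comps)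
  have "b 1 * (b11' * a 0 ^ 7) = b 1 * (b 1 * b11)"
    using p[OF r11] by (simp add: comps c8 d_eq b0) algebra
  with b1 show "b11' * A$0^7 = B$1 * b11"
    by (simp add: comps)
  \<comment> \<open>Pairing \<open>B\<close> with its own shift \<open>E 2\<close> produces the
    quadratic forms in \<open>b\<close>. The scaling of the shift leaves a common factor
    \<open>a 0\<close>, to be cancelled; for \<open>E 4\<close> and \<open>E 6\<close> the common
    factors are \<open>a 0 ^ 3\<close> and \<open>a 0 ^ 5 * b 1\<close>.\<close>
  have "a 0 * (b12' * (a 0^6 * b 1)) = a 0 * (b 1^2 * b12 + (2 * b 1 * b 3 - b 2^2) * b14
                + (2 * b 1 * b 5 - 2 * b 2 * b 4 + b 3^2) * b16)"
    using p[OF r12] by (simp add: comps c8 c2 m2 d_eq b0) algebra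
  with a0 show "b12' * (A$0^6 * B$1) = B$1^2 * b12 + (2 * B$1 * B$3 - B$2^2) * b14
                + (2 * B$1 * B$5 - 2 * B$2 * B$4 + B$3^2) * b16"
    by (simp add: comps)
  have "a 0 ^ 3 * (b14' * (a 0^4 * b 1)) = a 0 ^ 3 * (b 1^2 * b14 + (2 * b 1 * b 3 - b 2^2) * b16)"
    using p[OF r14] by (simp add: comps c8 c4 m4 d_eq b0) algebra
  with a0 show "b14' * (A$0^4 * B$1) = B$1^2 * b14 + (2 * B$1 * B$3 - B$2^2) * b16"
    by (simp add: comps)
  have "(a 0 ^ 5 * b 1) * (b16' * a 0 ^ 2) = (a 0 ^ 5 * b 1) * (b 1 * b16)"
    using p[OF r16] by (simp add: comps c8 c6 d_eq b0) algebra
  with a0 b1 show "b16' * A$0^2 = B$1 * b16"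
    by (simp add: comps)
qed

context
  fixes b00 b01 b11 b12 b14 b16 a0 a1 c1 c2 c3 c4 c5 :: complex
begin

text \<open>The columns are forced by the recursion \<open>e\<^sub>i\<^sub>+\<^sub>1 \<mapsto> [image of e\<^sub>i, image of e\<^sub>0]\<close> in \<open>L(\<alpha>)\<close>,
  starting from \<open>e\<^sub>0 \<mapsto> a\<^sub>0 e\<^sub>0 + a\<^sub>1 e\<^sub>1\<close> and \<open>e\<^sub>1 \<mapsto> c\<^sub>1 e\<^sub>1 + \<dots> + c\<^sub>5 e\<^sub>5\<close>.\<close>

definition L_change :: "complex ^ 9 \<Rightarrow> complex ^ 9" where
  "L_change x = (\<chi> k.
     if k = 0 then a0 * x$0
     else if k = 1 then a1 * x$0 + c1 * x$1
     else if k = 2 then c2 * x$1 + a0 * c1 * x$2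
     else if k = 3 then c3 * x$1 + a0 * c2 * x$2 + a0^2 * c1 * x$3
     else if k = 4 then c4 * x$1 + a0 * c3 * x$2 + a0^2 * c2 * x$3 + a0^3 * c1 * x$4
     else if k = 5 then c5 * x$1 + a0 * c4 * x$2 + a0^2 * c3 * x$3 + a0^3 * c2 * x$4 + a0^4 * c1 * x$5
     else if k = 6 then a0 * c5 * x$2 + a0^2 * c4 * x$3 + a0^3 * c3 * x$4 + a0^4 * c2 * x$5
       + a0^5 * c1 * x$6
     else if k = 7 then a0^2 * c5 * x$3 + a0^3 * c4 * x$4 + a0^4 * c3 * x$5 + a0^5 * c2 * x$6
       + a0^6 * c1 * x$7
     else a1 * (b11 * c1 - b12 * c2 - b14 * c4) * x$2
       - a0 * a1 * (b12 * c1 + b14 * c3 + b16 * c5) * x$3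
       + (a0^3 * c5 - a0^2 * a1 * (b14 * c2 + b16 * c4)) * x$4
       + (a0^4 * c4 - a0^3 * a1 * (b14 * c1 + b16 * c3)) * x$5
       + (a0^5 * c3 - a0^4 * a1 * b16 * c2) * x$6
       + (a0^6 * c2 - a0^5 * a1 * b16 * c1) * x$7
       + a0^7 * c1 * x$8)"

lemma linear_L_change: "Vector_Spaces.linear (*s) (*s) L_change"
  by unfold_locales (simp_all add: L_change_def vec_eq_iff forall_9 algebra_simps)

text \<open>The matrix of \<open>L_change\<close> is lower triangular, with diagonal
  \<open>a0\<close>, \<open>c1\<close>, \<open>a0 * c1\<close>, ..., \<open>a0^7 * c1\<close>, so
  the kernel is eliminated one coordinate at a time.\<close>

lemma bij_L_change:
  assumes "a0 \<noteq> 0" "c1 \<noteq> 0"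
  shows "bij L_change"
proof -
  interpret lin: Vector_Spaces.linear "(*s)" "(*s)" L_change by (fact linear_L_change)
  have "x = 0" if "L_change x = 0" for x
  proof -
    have eq: "L_change x $ k = 0" for k using that by simp
    have "x$0 = 0" using eq[of 0] assms by (simp add: L_change_def)
    moreover from this have "x$1 = 0" using eq[of 1] assms by (simp add: L_change_def)
    moreover from this have "x$2 = 0" using eq[of 2] assms by (simp add: L_change_def)
    moreover from this calculation have "x$3 = 0" using eq[of 3] assms by (simp add: L_change_def)
    moreover from this calculation have "x$4 = 0" using eq[of 4] assms by (simp add: L_change_def)
    moreover from this calculation have "x$5 = 0" using eq[of 5] assms by (simp add: L_change_def)
    moreover from this calculation have "x$6 = 0" using eq[of 6] assms by (simp add: L_change_def)
    moreover from this calculation have "x$7 = 0" using eq[of 7] assms by (simp add: L_change_def)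
    moreover from this calculation have "x$8 = 0" using eq[of 8] assms by (simp add: L_change_def)
    ultimately show ?thesis by (simp add: vec_eq_iff forall_9)
  qed
  then have "inj L_change" by (simp add: lin.inj_iff_eq_0)
  then show ?thesis
    using vec.linear_injective_imp_surjective[OF linear_L_change] by (simp add: bij_def)
qed

lemma L_change_hom:
  assumes p00: "b00' * (a0^7 * c1) = a0^2 * b00 + a0 * a1 * b01 + a1^2 * b11"
    and p01: "b01' * a0^7 = 2 * a1 * b11 + a0 * b01"
    and p11: "b11' * a0^7 = c1 * b11"
    and p12: "b12' * (a0^6 * c1) = c1^2 * b12 + (2 * c1 * c3 - c2^2) * b14
                + (2 * c1 * c5 - 2 * c2 * c4 + c3^2) * b16"
    and p14: "b14' * (a0^4 * c1) = c1^2 * b14 + (2 * c1 * c3 - c2^2) * b16"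
    and p16: "b16' * a0^2 = c1 * b16"
  shows "L_change (L b00' b01' b11' b12' b14' b16' x y)
    = L b00 b01 b11 b12 b14 b16 (L_change x) (L_change y)"
proof -
  let ?M = "L b00' b01' b11' b12' b14' b16' x y"
  let ?L = "L b00 b01 b11 b12 b14 b16 (L_change x) (L_change y)"
  \<comment> \<open>The structure parameters enter a bracket only in coordinate 8, which rows 0 to 7
    of \<open>L_change\<close> do not read, so these coordinates agree identically.\<close>
  have low: "L_change ?M $ 0 = ?L $ 0" "L_change ?M $ 1 = ?L $ 1" "L_change ?M $ 2 = ?L $ 2"
    "L_change ?M $ 3 = ?L $ 3" "L_change ?M $ 4 = ?L $ 4" "L_change ?M $ 5 = ?L $ 5"
    "L_change ?M $ 6 = ?L $ 6" "L_change ?M $ 7 = ?L $ 7"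
    by (simp_all add: L_component) (simp_all add: L_change_def L_component algebra_simps eval_nat_numeral)
  \<comment> \<open>The primed parameters reach \<open>L_change ?M\<close> only through its last
    term \<open>a0^7 * c1 * ?M $ 8\<close>. The powers are grouped so that the left sides of
    \<open>p00\<close> to \<open>p16\<close> appear literally and can be rewritten.\<close>
  have "a0^7 * c1 * ?M $ 8 = a0^7 * c1 * (x$7 * y$0 - x$0 * y$7)
      + (b00' * (a0^7 * c1)) * (x$0 * y$0) + c1 * (b01' * a0^7) * (x$0 * y$1)
      + c1 * (b11' * a0^7) * (x$1 * y$1)
      + a0 * (b12' * (a0^6 * c1)) * (x$1 * y$2 - x$2 * y$1)
      + a0^3 * (b14' * (a0^4 * c1)) * (x$1 * y$4 - x$4 * y$1 - x$2 * y$3 + x$3 * y$2)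
      + a0^5 * c1 * (b16' * a0^2) * (x$1 * y$6 - x$6 * y$1 - x$2 * y$5 + x$5 * y$2
                + x$3 * y$4 - x$4 * y$3)"
    by (simp add: L_component) algebra
  note top = this[unfolded p00 p01 p11 p12 p14 p16]
  \<comment> \<open>\<open>?L\<close> is expanded first, so that \<open>?M $ 8\<close> is still
    folded when \<open>top\<close> replaces its multiple.\<close>
  have "L_change ?M $ 8 = ?L $ 8"
    by (simp only: L_component[of _ _ _ _ _ _ "L_change x"], simp add: L_change_def top,
        simp add: L_component) algebra
  with low show ?thesis by (simp only: vec_eq_iff forall_9)
qed

end

theorem theorem3p5:
  fixes b00 b01 b11 b12 b14 b16 b00' b01' b11' b12' b14' b16' :: complex
  shows "leibniz_isomorphic (*s) (L b00 b01 b11 b12 b14 b16) (*s) (L b00' b01' b11' b12' b14' b16')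
    \<longleftrightarrow>
    (\<exists>A0 A1 B1 B2 B3 B4 B5 :: complex.
       A0 * B1 \<noteq> 0 \<and>
       b00' = (A0^2 * b00 + A0 * A1 * b01 + A1^2 * b11) / (A0^7 * B1) \<and>
       b01' = (2 * A1 * b11 + A0 * b01) / A0^7 \<and>
       b11' = B1 * b11 / A0^7 \<and>
       b12' = (B1^2 * b12 + (2 * B1 * B3 - B2^2) * b14
                + (2 * B1 * B5 - 2 * B2 * B4 + B3^2) * b16) / (A0^6 * B1) \<and>
       b14' = (B1^2 * b14 + (2 * B1 * B3 - B2^2) * b16) / (A0^4 * B1) \<and>
       b16' = B1 * b16 / A0^2)"
    (is "?iso \<longleftrightarrow> ?params")
proof
  assume ?iso
  \<comment> \<open>The formulas express the primed parameters through images inside the unprimed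
    algebra, so the given isomorphism has to be inverted.\<close>
  then obtain g :: "complex ^ 9 \<Rightarrow> complex ^ 9"
    where "Vector_Spaces.linear (*s) (*s) g" "inj g"
      "\<And>x y. g (L b00' b01' b11' b12' b14' b16' x y) = L b00 b01 b11 b12 b14 b16 (g x) (g y)"
    using leibniz_isomorphic_sym unfolding leibniz_isomorphic_def by (metis bij_is_inj)
  note params = L_isomorphism_imp_parameters[OF this]
  show ?params
    by (rule exI[of _ "g (e 0) $ 0"], rule exI[of _ "g (e 0) $ 1"], rule exI[of _ "g (e 1) $ 1"],
        rule exI[of _ "g (e 1) $ 2"], rule exI[of _ "g (e 1) $ 3"], rule exI[of _ "g (e 1) $ 4"],
        rule exI[of _ "g (e 1) $ 5"])
      (use params in \<open>simp add: eq_divide_eq\<close>)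
next
  assume ?params
  then obtain A0 A1 B1 B2 B3 B4 B5 where nz: "A0 \<noteq> 0" "B1 \<noteq> 0" and params:
    "b00' * (A0^7 * B1) = A0^2 * b00 + A0 * A1 * b01 + A1^2 * b11"
    "b01' * A0^7 = 2 * A1 * b11 + A0 * b01"
    "b11' * A0^7 = B1 * b11"
    "b12' * (A0^6 * B1) = B1^2 * b12 + (2 * B1 * B3 - B2^2) * b14
                + (2 * B1 * B5 - 2 * B2 * B4 + B3^2) * b16"
    "b14' * (A0^4 * B1) = B1^2 * b14 + (2 * B1 * B3 - B2^2) * b16"
    "b16' * A0^2 = B1 * b16"
    by (auto simp: nonzero_eq_divide_eq)
  have "leibniz_isomorphic (*s) (L b00' b01' b11' b12' b14' b16') (*s) (L b00 b01 b11 b12 b14 b16)"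
    unfolding leibniz_isomorphic_def
    by (intro conjI allI exI[of _ "L_change b11 b12 b14 b16 A0 A1 B1 B2 B3 B4 B5"]
        leibniz_algebra_L linear_L_change bij_L_change[OF nz] L_change_hom[OF params])
  then show ?iso by (rule leibniz_isomorphic_sym)
qed

end
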